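(* For every normal space $X$, $e(X)\leq 2^{ll(X)}$.
   Context: Normal spaces are assumed to be $T_1$. For a topological space $X$, the extent of $X$ is the cardinal $e(X)=\sup\{|F| : F\subset X \text{ is closed and discrete}\}$, where "discrete" means discrete in the subspace topology. A family of sets is called linked if every two of its elements have nonempty intersection. The linked-Lindelöf number of $X$ is the cardinal $ll(X)=\min\{\tau : \text{every open cover of } X \text{ has a subcover representable as the union of at most } \tau \text{ many linked subfamilies}\}$. *)

theory Defs
  imports "HOL-Analysis.Abstract_Topological_Spaces"
begin

unbundle cardinal_syntax

text \<open>
  Cardinals are rendered as in the HOL cardinal library: relations satisfying
  \<^const>\<open>Card_order\<close>, compared by \<open>\<le>o\<close> and identified up to \<open>=o\<close>. Finite cardinals
  (including 0) are allowed. A minimum of a property of cardinals is therefore determined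
  only up to \<open>=o\<close>, and \<open>SOME\<close> picks a representative.
\<close>

definition is_least_cardinal :: "('c rel \<Rightarrow> bool) \<Rightarrow> 'c rel \<Rightarrow> bool" where
  "is_least_cardinal P r \<longleftrightarrow>
     Card_order r \<and> P r \<and> (\<forall>s. Card_order s \<and> P s \<longrightarrow> r \<le>o s)"

definition least_cardinal :: "('c rel \<Rightarrow> bool) \<Rightarrow> 'c rel" where
  "least_cardinal P = (SOME r. is_least_cardinal P r)"

definition closed_discrete_in :: "'a topology \<Rightarrow> 'a set \<Rightarrow> bool" where
  "closed_discrete_in X F \<longleftrightarrow> closedin X F \<and> subtopology X F = discrete_topology F"

definition extent_bound :: "'a topology \<Rightarrow> 'c rel \<Rightarrow> bool" where
  "extent_bound X \<kappa> \<longleftrightarrow> (\<forall>F. closed_discrete_in X F \<longrightarrow> |F| \<le>o \<kappa>)"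

text \<open>
  The supremum is the least upper bound in the order of cardinals. Cardinals living on the
  type of points suffice to express it, as every subset of the space has cardinality at most
  that of the space; see \<open>extent_least\<close> below.
\<close>

definition extent :: "'a topology \<Rightarrow> 'a rel" where
  "extent X = least_cardinal (extent_bound X)"

definition open_cover :: "'a topology \<Rightarrow> 'a set set \<Rightarrow> bool" where
  "open_cover X \<U> \<longleftrightarrow> (\<forall>U\<in>\<U>. openin X U) \<and> \<Union>\<U> = topspace X"

text \<open>
  The two elements are not required to be distinct, so the members of a linked family are
  nonempty. This does not affect the number below, since an empty set may be removed from any
  subcover.
\<close>

definition linked :: "'a set set \<Rightarrow> bool" where
  "linked \<L> \<longleftrightarrow> (\<forall>A\<in>\<L>. \<forall>B\<in>\<L>. A \<inter> B \<noteq> {})"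

definition linked_lindelof_bound :: "'a topology \<Rightarrow> 'c rel \<Rightarrow> bool" where
  "linked_lindelof_bound X \<tau> \<longleftrightarrow>
     (\<forall>\<U>. open_cover X \<U> \<longrightarrow>
        (\<exists>\<V> \<LL>. \<V> \<subseteq> \<U> \<and> open_cover X \<V> \<and>
           \<V> = \<Union>\<LL> \<and> |\<LL>| \<le>o \<tau> \<and> (\<forall>\<L>\<in>\<LL>. linked \<L>)))"

text \<open>
  Cardinals living on the type of sets of points suffice here, because an open cover is the
  union of its singleton subfamilies; see \<open>linked_lindelof_number_least\<close> below.
\<close>

definition linked_lindelof_number :: "'a topology \<Rightarrow> 'a set rel" where
  "linked_lindelof_number X = least_cardinal (linked_lindelof_bound X)"


lemma is_least_cardinal_least_cardinal:
  assumes "Card_order r" "P r"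
  shows "is_least_cardinal P (least_cardinal P)"
proof -
  obtain m where m: "m \<in> {s. Card_order s \<and> P s}"
    and min: "\<And>s. (s, m) \<in> ordLess \<Longrightarrow> s \<notin> {s. Card_order s \<and> P s}"
    using wfE_min[OF wf_ordLess, of r "{s. Card_order s \<and> P s}"] assms by blast
  have "m \<le>o s" if "Card_order s" "P s" for s
    using min[of s] that m card_order_on_well_order_on
      not_ordLess_iff_ordLeq[of m s] by blast
  then have "is_least_cardinal P m"
    using m by (auto simp: is_least_cardinal_def)
  then show ?thesis
    unfolding least_cardinal_def by (rule someI)
qed

lemma is_least_cardinal_unique:
  "is_least_cardinal P r \<Longrightarrow> is_least_cardinal P s \<Longrightarrow> r =o s"
  by (simp add: is_least_cardinal_def ordIso_iff_ordLeq)

lemma extent_bound_mono: "extent_bound X r \<Longrightarrow> r \<le>o s \<Longrightarrow> extent_bound X s"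
  unfolding extent_bound_def using ordLeq_transitive by blast

lemma linked_lindelof_bound_mono:
  "linked_lindelof_bound X r \<Longrightarrow> r \<le>o s \<Longrightarrow> linked_lindelof_bound X s"
  unfolding linked_lindelof_bound_def by (meson ordLeq_transitive)

lemma is_least_cardinal_extent: "is_least_cardinal (extent_bound X) (extent X)"
  unfolding extent_def
  by (rule is_least_cardinal_least_cardinal[of "|UNIV|"])
     (auto simp: extent_bound_def card_of_mono1 card_of_Card_order)

lemma is_least_cardinal_linked_lindelof_number:
  "is_least_cardinal (linked_lindelof_bound X) (linked_lindelof_number X)"
  unfolding linked_lindelof_number_def
proof (rule is_least_cardinal_least_cardinal[of "|UNIV|"])
  show "linked_lindelof_bound X |UNIV :: 'a set set|"
    unfolding linked_lindelof_bound_def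
  proof (intro allI impI)
    fix \<U> assume \<U>: "open_cover X \<U>"
    let ?V = "\<U> - {{}}" and ?L = "(\<lambda>U. {U}) ` (\<U> - {{}})"
    have "open_cover X ?V"
      using \<U> by (auto simp: open_cover_def)
    moreover have "|?L| \<le>o |UNIV :: 'a set set|"
      by (meson card_of_image card_of_mono1 ordLeq_transitive subset_UNIV)
    moreover have "\<forall>\<L>\<in>?L. linked \<L>" "?V = \<Union>?L" "?V \<subseteq> \<U>"
      by (auto simp: linked_def)
    ultimately show "\<exists>\<V> \<LL>. \<V> \<subseteq> \<U> \<and> open_cover X \<V> \<and>
        \<V> = \<Union>\<LL> \<and> |\<LL>| \<le>o |UNIV :: 'a set set| \<and> (\<forall>\<L>\<in>\<LL>. linked \<L>)"
      by blast
  qed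
qed (rule card_of_Card_order)

text \<open>The next two facts compare with cardinals on an arbitrary type \<^typ>\<open>'c\<close>.\<close>

lemma extent_least:
  fixes X :: "'a topology" and s :: "'c rel"
  assumes "Card_order s" "extent_bound X s"
  shows "extent X \<le>o s"
proof (rule ccontr)
  have e: "Card_order (extent X)" "\<And>r :: 'a rel. Card_order r \<Longrightarrow> extent_bound X r \<Longrightarrow> extent X \<le>o r"
    using is_least_cardinal_extent[of X] by (auto simp: is_least_cardinal_def)
  assume "\<not> extent X \<le>o s"
  then have "s <o extent X"
    using ordLess_or_ordLeq[OF card_order_on_well_order_on[OF assms(1)]
        card_order_on_well_order_on[OF e(1)]] by blast
  then obtain p :: "'a rel" where p: "s =o p" "p <o extent X"
    using internalize_ordLess[THEN iffD1] by metis
  have card: "Card_order p"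
    by (rule Card_order_ordIso2[OF assms(1) p(1)])
  have bound: "extent_bound X p"
    by (rule extent_bound_mono[OF assms(2) p(1)[unfolded ordIso_iff_ordLeq, THEN conjunct1]])
  show False
    by (rule notE[OF not_ordLess_ordLeq[OF p(2)] e(2)[OF card bound]])
qed

lemma linked_lindelof_number_least:
  fixes X :: "'a topology" and s :: "'c rel"
  assumes "Card_order s" "linked_lindelof_bound X s"
  shows "linked_lindelof_number X \<le>o s"
proof (rule ccontr)
  let ?l = "linked_lindelof_number X"
  have e: "Card_order ?l" "\<And>r :: 'a set rel. Card_order r \<Longrightarrow> linked_lindelof_bound X r \<Longrightarrow> ?l \<le>o r"
    using is_least_cardinal_linked_lindelof_number[of X] by (auto simp: is_least_cardinal_def)
  assume "\<not> ?l \<le>o s"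
  then have "s <o ?l"
    using ordLess_or_ordLeq[OF card_order_on_well_order_on[OF assms(1)]
        card_order_on_well_order_on[OF e(1)]] by blast
  then obtain p :: "'a set rel" where p: "s =o p" "p <o ?l"
    using internalize_ordLess[THEN iffD1] by metis
  have card: "Card_order p"
    by (rule Card_order_ordIso2[OF assms(1) p(1)])
  have bound: "linked_lindelof_bound X p"
    by (rule linked_lindelof_bound_mono[OF assms(2) p(1)[unfolded ordIso_iff_ordLeq, THEN conjunct1]])
  show False
    by (rule notE[OF not_ordLess_ordLeq[OF p(2)] e(2)[OF card bound]])
qed

end

theory Submission
  imports Defs
begin

text \<open>
  Let \<open>\<tau>\<close> be the linked-Lindelof number and \<open>F\<close> a closed discrete set. An open neighbourhood
  assignment on \<open>F\<close> can be shrunk so that each neighbourhood contains just one point of \<open>F\<close>;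
  together with the complement of \<open>F\<close> these sets cover the space, and no neighbourhood may be
  omitted from a subcover. Splitting a subcover into \<open>\<tau>\<close> linked subfamilies thus colours \<open>F\<close>
  with \<open>\<tau>\<close> colours so that points whose neighbourhoods are disjoint get different colours
  (\<open>linked_lindelof_colouring\<close>). It remains to find, in a normal space, neighbourhoods that are
  disjoint often enough to force many colours.

  For infinite \<open>F\<close> the neighbourhoods can realise a shift graph. Since \<open>|F \<times> F| = |F|\<close>, index
  points of \<open>F\<close> injectively by pairs \<open>(a, b)\<close> of distinct elements of a set \<open>K\<close> with
  \<open>|K| = |F|\<close>. For each \<open>b\<close>, normality provides disjoint open sets \<open>U b\<close> and \<open>V b\<close>, the first
  around the points whose second coordinate is \<open>b\<close>, the second around all the others. Give the
  point \<open>(a, b)\<close> the neighbourhood \<open>U b \<inter> V a\<close>. Then \<open>(a, b)\<close> and \<open>(b, d)\<close> are separated by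
  \<open>U b\<close> and \<open>V b\<close>, so they have different colours. As for every shift graph, the set of
  colours occurring on the pairs that start with \<open>b\<close> determines \<open>b\<close>, so that \<open>|K| \<le> 2\<^sup>\<tau>\<close>
  (\<open>shift_colouring_bound\<close>).

  For finite \<open>F\<close> normality separates all points of \<open>F\<close> simultaneously, so even \<open>|F| \<le> \<tau>\<close>.
\<close>

lemma closed_discrete_in_subset_closedin:
  assumes "closed_discrete_in X F" "B \<subseteq> F"
  shows "closedin X B"
proof (rule closedin_trans_full)
  show "closedin (subtopology X F) B" "closedin X F"
    using assms by (simp_all add: closed_discrete_in_def)
qed

lemma closed_discrete_in_subset:
  assumes "closed_discrete_in X F" "B \<subseteq> F"
  shows "closed_discrete_in X B"
proof -
  have "subtopology X B = subtopology (subtopology X F) B"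
    using assms(2) by (simp add: subtopology_subtopology Int_absorb1)
  also have "\<dots> = discrete_topology B"
    using assms by (simp add: closed_discrete_in_def Int_absorb1)
  finally show ?thesis
    using closed_discrete_in_subset_closedin[OF assms] by (simp add: closed_discrete_in_def)
qed

text \<open>
  This is the only use of the covering hypothesis. The colour of an index is a linked subfamily
  that contains its shrunken neighbourhood; two sets of one linked family meet, and so do the
  original, larger neighbourhoods.
\<close>

lemma linked_lindelof_colouring:
  fixes \<tau> :: "'c rel"
  assumes F: "closed_discrete_in X (q ` I)" and inj: "inj_on q I"
    and N: "\<And>i. i \<in> I \<Longrightarrow> openin X (N i)" "\<And>i. i \<in> I \<Longrightarrow> q i \<in> N i"
    and \<tau>: "Card_order \<tau>" "linked_lindelof_bound X \<tau>"
  obtains c :: "'i \<Rightarrow> 'c" where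
    "c ` I \<subseteq> Field \<tau>"
    "\<And>i j. i \<in> I \<Longrightarrow> j \<in> I \<Longrightarrow> c i = c j \<Longrightarrow> N i \<inter> N j \<noteq> {}"
proof -
  define M where "M i = N i - (q ` I - {q i})" for i
  define W where "W = topspace X - q ` I"
  have M: "openin X (M i)" if "i \<in> I" for i
    unfolding M_def using N(1)[OF that] closed_discrete_in_subset_closedin[OF F]
    by (intro openin_diff) auto
  have W: "openin X W"
    unfolding W_def using F by (auto simp: closed_discrete_in_def)
  have FX: "q ` I \<subseteq> topspace X"
    using F by (auto simp: closed_discrete_in_def dest: closedin_subset)
  have cover: "open_cover X (insert W (M ` I))"
    unfolding open_cover_def
  proof
    show "\<forall>U\<in>insert W (M ` I). openin X U"
      using M W by auto
    have "topspace X \<subseteq> \<Union>(insert W (M ` I))"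
      using N(2) by (auto simp: W_def M_def)
    moreover have "\<Union>(insert W (M ` I)) \<subseteq> topspace X"
      using M W openin_subset by fastforce
    ultimately show "\<Union>(insert W (M ` I)) = topspace X"
      by blast
  qed
  from \<tau>(2)[unfolded linked_lindelof_bound_def, rule_format, OF cover]
  obtain \<V> \<LL> where \<V>: "\<V> \<subseteq> insert W (M ` I)" "open_cover X \<V>" "\<V> = \<Union>\<LL>"
    and \<LL>: "|\<LL>| \<le>o \<tau>" "\<forall>\<L>\<in>\<LL>. linked \<L>"
    by (elim exE conjE) (rule that)
  have M_kept: "M i \<in> \<V>" if "i \<in> I" for i
  proof -
    have "q i \<in> \<Union>\<V>"
      using \<V>(2) subsetD[OF FX imageI[OF that]] by (simp add: open_cover_def)
    then obtain V where V: "V \<in> \<V>" "q i \<in> V"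
      by (rule UnionE)
    have "V \<noteq> W"
      using V(2) that by (auto simp: W_def)
    then obtain k where k: "k \<in> I" "V = M k"
      using V(1) \<V>(1) by blast
    then have "q i = q k"
      using V(2) that by (auto simp: M_def)
    then have "V = M i"
      using inj_onD[OF inj] k that by blast
    with V show ?thesis by simp
  qed
  then have "\<forall>i\<in>I. \<exists>\<L>. \<L> \<in> \<LL> \<and> M i \<in> \<L>"
    using \<V>(3) by auto
  then obtain L where L: "\<And>i. i \<in> I \<Longrightarrow> L i \<in> \<LL> \<and> M i \<in> L i"
    using bchoice by metis
  have "|\<LL>| \<le>o |Field \<tau>|"
    using \<LL>(1) \<tau>(1) card_of_Field_ordIso ordIso_symmetric ordLeq_ordIso_trans by blast
  then obtain g where g: "inj_on g \<LL>" "g ` \<LL> \<subseteq> Field \<tau>"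
    using card_of_ordLeq[of \<LL> "Field \<tau>"] by blast
  show thesis
  proof (rule that[of "g \<circ> L"])
    show "(g \<circ> L) ` I \<subseteq> Field \<tau>"
      using g(2) L by auto
    fix i j assume ij: "i \<in> I" "j \<in> I" "(g \<circ> L) i = (g \<circ> L) j"
    then have "L i = L j"
      using g(1) L by (auto dest: inj_onD)
    then have "M i \<inter> M j \<noteq> {}"
      using L[OF ij(1)] L[OF ij(2)] \<LL>(2) unfolding linked_def by metis
    then show "N i \<inter> N j \<noteq> {}"
      by (auto simp: M_def)
  qed
qed

lemma normal_space_separate_closed_discrete:
  assumes "normal_space X" "closed_discrete_in X F"
  obtains U V where
    "\<And>B. B \<subseteq> F \<Longrightarrow> openin X (U B)" "\<And>B. B \<subseteq> F \<Longrightarrow> openin X (V B)"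
    "\<And>B. B \<subseteq> F \<Longrightarrow> B \<subseteq> U B" "\<And>B. B \<subseteq> F \<Longrightarrow> F - B \<subseteq> V B"
    "\<And>B. B \<subseteq> F \<Longrightarrow> U B \<inter> V B = {}"
proof -
  have "\<exists>U V. openin X U \<and> openin X V \<and> B \<subseteq> U \<and> F - B \<subseteq> V \<and> U \<inter> V = {}" if "B \<subseteq> F" for B
  proof -
    have "closedin X B" "closedin X (F - B)" "disjnt B (F - B)"
      using closed_discrete_in_subset_closedin[OF assms(2)] that by (auto simp: disjnt_def)
    then show ?thesis
      using assms(1) unfolding normal_space_def by (metis disjnt_def)
  qed
  then show thesis
    using that by metis
qed

text \<open>
  The classical lower bound for the chromatic number of a shift graph. Were two vertices
  \<open>b \<noteq> b'\<close> to emit the same set of colours, the colour of \<open>(b, b')\<close> would occur on some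
  \<open>(b', d)\<close>, which is adjacent to \<open>(b, b')\<close>. Using ordered pairs of distinct elements in place
  of increasing pairs saves choosing an ordering of \<open>K\<close>.
\<close>

lemma shift_colouring_bound:
  assumes C: "\<And>a b. a \<in> K \<Longrightarrow> b \<in> K \<Longrightarrow> a \<noteq> b \<Longrightarrow> c (a, b) \<in> C"
    and shift: "\<And>a b d. a \<in> K \<Longrightarrow> b \<in> K \<Longrightarrow> d \<in> K \<Longrightarrow> a \<noteq> b \<Longrightarrow> b \<noteq> d \<Longrightarrow> c (a, b) \<noteq> c (b, d)"
  shows "|K| \<le>o |Pow C|"
proof -
  define T where "T b = {c (b, d) | d. d \<in> K \<and> b \<noteq> d}" for b
  have "inj_on T K"
  proof (rule inj_onI, rule ccontr)
    fix b b' assume b: "b \<in> K" "b' \<in> K" "T b = T b'" "b \<noteq> b'"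
    then have "c (b, b') \<in> T b'"
      unfolding b(3)[symmetric] by (auto simp: T_def)
    then obtain d where "d \<in> K" "b' \<noteq> d" "c (b, b') = c (b', d)"
      by (auto simp: T_def)
    with shift b show False by blast
  qed
  moreover have "T ` K \<subseteq> Pow C"
    using C by (auto simp: T_def)
  ultimately show ?thesis
    using card_of_ordLeq by blast
qed

text \<open>
  Separating all points of \<open>F\<close> from each other at once would need infinite intersections of
  open sets, and may be impossible in a normal space. A shift graph avoids this: there is one
  separation for each \<open>b \<in> K\<close>, and all edges at the point \<open>(a, b)\<close> come from the separations
  for \<open>a\<close> and \<open>b\<close>, so that two open sets suffice for its neighbourhood.
\<close>

lemma shift_indexed_closed_discrete_bound:
  assumes normal: "normal_space X"
    and \<tau>: "Card_order \<tau>" "linked_lindelof_bound X \<tau>"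
    and I: "I = {(a, b). a \<in> K \<and> b \<in> K \<and> a \<noteq> b}"
    and F: "closed_discrete_in X (q ` I)" and inj: "inj_on q I"
  shows "|K| \<le>o |Pow (Field \<tau>)|"
proof -
  obtain U V where
    UV: "\<And>B. B \<subseteq> q ` I \<Longrightarrow> openin X (U B)" "\<And>B. B \<subseteq> q ` I \<Longrightarrow> openin X (V B)"
      "\<And>B. B \<subseteq> q ` I \<Longrightarrow> B \<subseteq> U B" "\<And>B. B \<subseteq> q ` I \<Longrightarrow> q ` I - B \<subseteq> V B"
      "\<And>B. B \<subseteq> q ` I \<Longrightarrow> U B \<inter> V B = {}"
    using normal_space_separate_closed_discrete[OF normal F] by metis
  define A where "A b = q ` {i \<in> I. snd i = b}" for b
  have A: "A b \<subseteq> q ` I" for b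
    by (auto simp: A_def)
  define N where "N i = U (A (snd i)) \<inter> V (A (fst i))" for i
  have N_open: "openin X (N i)" for i
    by (auto simp: N_def UV(1,2) A)
  have N_mem: "q i \<in> N i" if i: "i \<in> I" for i
  proof -
    have "q i \<in> A (snd i)"
      using i by (simp add: A_def)
    moreover have "q i \<notin> A (fst i)"
    proof
      assume "q i \<in> A (fst i)"
      then obtain j where "j \<in> I" "snd j = fst i" "q i = q j"
        unfolding A_def by blast
      then have "snd i = fst i"
        using inj_onD[OF inj] i by metis
      with i show False
        by (auto simp: I)
    qed
    ultimately show ?thesis
      using subsetD[OF UV(3)[OF A]] subsetD[OF UV(4)[OF A]] i by (simp add: N_def)
  qed
  obtain c where c: "c ` I \<subseteq> Field \<tau>"
    "\<And>i j. i \<in> I \<Longrightarrow> j \<in> I \<Longrightarrow> c i = c j \<Longrightarrow> N i \<inter> N j \<noteq> {}"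
    using linked_lindelof_colouring[OF F inj N_open N_mem \<tau>] by metis
  have disjoint: "N (a, b) \<inter> N (b, d) = {}" for a b d
    using UV(5)[OF A[of b]] by (auto simp: N_def)
  show ?thesis
  proof (rule shift_colouring_bound)
    show "c (a, b) \<in> Field \<tau>" if "a \<in> K" "b \<in> K" "a \<noteq> b" for a b
      using c(1) that by (auto simp: I)
    show "c (a, b) \<noteq> c (b, d)" if "a \<in> K" "b \<in> K" "d \<in> K" "a \<noteq> b" "b \<noteq> d" for a b d
      using c(2)[of "(a, b)" "(b, d)"] disjoint that by (auto simp: I)
  qed
qed

lemma infinite_closed_discrete_bound:
  assumes "normal_space X" "Card_order \<tau>" "linked_lindelof_bound X \<tau>"
    and F: "closed_discrete_in X F" "infinite F"
  shows "|F| \<le>o |Pow (Field \<tau>)|"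
proof -
  define I where "I = {(a, b). a \<in> F \<and> b \<in> F \<and> a \<noteq> b}"
  have "|F \<times> F| \<le>o |F|"
    using card_of_Times_same_infinite[OF F(2)] ordIso_iff_ordLeq by blast
  then obtain q where q: "inj_on q (F \<times> F)" "q ` (F \<times> F) \<subseteq> F"
    using card_of_ordLeq[of "F \<times> F" F] by blast
  have "I \<subseteq> F \<times> F"
    by (auto simp: I_def)
  then have "inj_on q I" "q ` I \<subseteq> F"
    using q inj_on_subset by blast+
  then show ?thesis
    using shift_indexed_closed_discrete_bound[OF assms(1-3) I_def]
      closed_discrete_in_subset[OF F(1)] by blast
qed

text \<open>
  Finiteness makes the intersection of all sets \<open>V {y}\<close> with \<open>y \<noteq> x\<close> open, so the neighbourhoods
  can be chosen pairwise disjoint and all colours differ.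
\<close>

lemma finite_closed_discrete_bound:
  assumes normal: "normal_space X"
    and \<tau>: "Card_order \<tau>" "linked_lindelof_bound X \<tau>"
    and F: "closed_discrete_in X F" "finite F"
  shows "|F| \<le>o |Field \<tau>|"
proof -
  obtain U V where
    UV: "\<And>B. B \<subseteq> F \<Longrightarrow> openin X (U B)" "\<And>B. B \<subseteq> F \<Longrightarrow> openin X (V B)"
      "\<And>B. B \<subseteq> F \<Longrightarrow> B \<subseteq> U B" "\<And>B. B \<subseteq> F \<Longrightarrow> F - B \<subseteq> V B"
      "\<And>B. B \<subseteq> F \<Longrightarrow> U B \<inter> V B = {}"
    using normal_space_separate_closed_discrete[OF normal F(1)] by metis
  define N where "N x = \<Inter>(insert (U {x}) ((\<lambda>y. V {y}) ` (F - {x})))" for x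
  have N_open: "openin X (N x)" if "x \<in> F" for x
    unfolding N_def using F(2) UV(1,2) that by (intro openin_Inter) auto
  have N_mem: "x \<in> N x" if "x \<in> F" for x
  proof -
    have "x \<in> U {x}"
      using UV(3)[of "{x}"] that by simp
    moreover have "x \<in> V {y}" if "y \<in> F - {x}" for y
      using UV(4)[of "{y}"] \<open>x \<in> F\<close> that by auto
    ultimately show ?thesis
      by (simp add: N_def)
  qed
  have "closed_discrete_in X ((\<lambda>x. x) ` F)"
    using F(1) by simp
  then obtain c where c: "c ` F \<subseteq> Field \<tau>"
    "\<And>x y. x \<in> F \<Longrightarrow> y \<in> F \<Longrightarrow> c x = c y \<Longrightarrow> N x \<inter> N y \<noteq> {}"
    using linked_lindelof_colouring[OF _ inj_on_id2 N_open N_mem \<tau>] by metis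
  have "N x \<inter> N y = {}" if "x \<in> F" "y \<in> F" "x \<noteq> y" for x y
    using UV(5)[of "{x}"] that by (fastforce simp: N_def)
  then have "inj_on c F"
    using c(2) by (meson inj_onI)
  then show ?thesis
    using c(1) card_of_ordLeq by blast
qed

theorem theorem3:
  fixes X :: "'a topology"
  assumes "normal_space X" and "t1_space X"
  shows "extent X \<le>o ctwo ^c linked_lindelof_number X"
proof -
  let ?l = "linked_lindelof_number X"
  have l: "Card_order ?l" "linked_lindelof_bound X ?l"
    using is_least_cardinal_linked_lindelof_number[of X] by (auto simp: is_least_cardinal_def)
  have Pow: "|Pow (Field ?l)| =o ctwo ^c ?l"
    unfolding ctwo_def cexp_def Field_card_of by (rule card_of_Pow_Func)
  have "|F| \<le>o |Pow (Field ?l)|" if F: "closed_discrete_in X F" for F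
  proof (cases "finite F")
    case True
    then show ?thesis
      using finite_closed_discrete_bound[OF assms(1) l F] card_of_Pow ordLess_imp_ordLeq
        ordLeq_transitive by blast
  next
    case False
    then show ?thesis
      using infinite_closed_discrete_bound[OF assms(1) l F] by blast
  qed
  then have "extent_bound X (ctwo ^c ?l)"
    unfolding extent_bound_def using Pow ordLeq_ordIso_trans by blast
  then show ?thesis
    by (rule extent_least[OF Card_order_cexp])
qed

end
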